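(* Let $(W_i)_{i\in\mathbb{N}}$ be independent random matrices, $W_i\in\mathbb{R}^{N_{r_i}\times N_{c_i}}$ having i.i.d. $\mathcal{N}(0,\sigma_i^2)$ entries. Let $G$ be a (possibly disconnected) product graph each of whose inputs is either deterministic or (for edges) one of the matrices $W_i$. Then $$\mathbb{E}\{\mathbf{W}_G\}=\sum_{\phi\in\mathcal{P}(G)}\mathbf{W}_{G_\phi},$$ where $\phi$ runs over all admissible pairings of $G$.
   Context: A product graph is a triple $(G,\mathfrak{d},\mathfrak{C})$ (often just written $G$), where $G=(V,E)$ is a finite directed graph with $E\subseteq V\times V$, $\mathfrak{d}$ assigns to each vertex $v$ a dimension $\mathfrak{d}(v)\in\mathbb{N}_{>0}$, and $\mathfrak{C}$ consists of an input vector $\mathbf{X}_v\in\mathbb{R}^{\mathfrak{d}(v)}$ for each vertex and an input matrix $\mathbf{X}_e\in\mathbb{R}^{\mathfrak{d}(u)\times\mathfrak{d}(v)}$ for each edge $e=(u,v)$ ($u$ is the head, $v$ the tail). Its value is $$\mathbf{W}_G=\sum_{(i_v)_{v\in V}}\ \prod_{(u,v)\in E}[\mathbf{X}_{(u,v)}]_{i_ui_v}\prod_{w\in V}[\mathbf{X}_w]_{i_w}\in\mathbb{R},$$ the sum being over all $(i_v)_{v\in V}\in\prod_{v\in V}\{1,\dots,\mathfrak{d}(v)\}$. The same formula (one factor per edge) defines the value when loops and parallel edges are present, which may occur in $G_\phi$ below. $E_{\mathcal{W}}$ is the set of edges whose input is some random matrix $W_\ell$, and then $\ell(e):=\ell$;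 different edges may carry the same matrix. An admissible pairing is a partition $\phi$ of $E_{\mathcal{W}}$ into pairs $\{e,e'\}$ all satisfying $\ell(e)=\ell(e')$; $\mathcal{P}(G)$ is the set of these. $G_\phi$ is the product graph obtained from $G$ by identifying paired edges coherently with their orientation (head with head, tail with tail). Each edge resulting from the identification of two edges with input $W_\ell$ gets input $\sigma_\ell^2\mathbf{I}$, where $\mathbf{I}$ is the matrix with all entries equal to $1$; a vertex resulting from the identification of several vertices gets as input the entrywise product of their inputs; all other inputs are unchanged. *)

theory Defs
  imports
    "HOL-Probability.Probability"
    "Graph_Theory.Digraph"
    "Jordan_Normal_Form.Matrix"
begin

text \<open>
  The type of edge inputs is a parameter: \<^typ>\<open>real mat\<close> when all inputs are
  deterministic, and \<open>edge_input\<close> below when some of them are random matrices.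
  Arcs have a type of their own, so that loops and parallel arcs are allowed. Indices are
  0-based throughout.
\<close>

record ('v, 'e, 'x) product_graph =
  digr :: "('v, 'e) pre_digraph"
  vdim :: "'v \<Rightarrow> nat"
  vinput :: "'v \<Rightarrow> real Matrix.vec"
  einput :: "'e \<Rightarrow> 'x"

text \<open>
  The argument \<open>shape\<close> returns the number of rows and of columns of an edge input.
  Rows are indexed by the head and columns by the tail of an arc.
\<close>

definition wf_product_graph ::
  "('x \<Rightarrow> nat \<times> nat) \<Rightarrow> ('v, 'e, 'x) product_graph \<Rightarrow> bool" where
  "wf_product_graph shape G \<longleftrightarrow>
     fin_digraph (digr G) \<and>
     (\<forall>v\<in>verts (digr G). vdim G v > 0 \<and> vinput G v \<in> carrier_vec (vdim G v)) \<and>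
     (\<forall>e\<in>arcs (digr G).
        shape (einput G e) = (vdim G (head (digr G) e), vdim G (tail (digr G) e)))"

definition mat_shape :: "real mat \<Rightarrow> nat \<times> nat" where
  "mat_shape A = (dim_row A, dim_col A)"

definition graph_value :: "('v, 'e, real mat) product_graph \<Rightarrow> real" where
  "graph_value G =
     (\<Sum>i\<in>(\<Pi>\<^sub>E v\<in>verts (digr G). {..<vdim G v}).
        (\<Prod>e\<in>arcs (digr G). einput G e $$ (i (head (digr G) e), i (tail (digr G) e))) *
        (\<Prod>w\<in>verts (digr G). vec_index (vinput G w) (i w)))"

text \<open>
  The arcs of a digraph \<open>(V, E)\<close> with \<open>E \<subseteq> V \<times> V\<close> are the pairs themselves. The first
  component is the head (the opposite of the convention of \<open>with_proj\<close>).
\<close>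

definition simple_arcs :: "('v, 'v \<times> 'v) pre_digraph \<Rightarrow> bool" where
  "simple_arcs D \<longleftrightarrow> (\<forall>e\<in>arcs D. head D e = fst e \<and> tail D e = snd e)"

text \<open>\<open>Rand l\<close> stands for the random matrix \<open>W l\<close>.\<close>

datatype edge_input = Det "real mat" | Rand nat

fun input_shape :: "(nat \<Rightarrow> nat) \<Rightarrow> (nat \<Rightarrow> nat) \<Rightarrow> edge_input \<Rightarrow> nat \<times> nat" where
  "input_shape Nr Nc (Det A) = mat_shape A"
| "input_shape Nr Nc (Rand l) = (Nr l, Nc l)"

fun realize_input :: "(nat \<Rightarrow> real mat) \<Rightarrow> edge_input \<Rightarrow> real mat" where
  "realize_input w (Det A) = A"
| "realize_input w (Rand l) = w l"

definition realize ::
  "(nat \<Rightarrow> real mat) \<Rightarrow> ('v, 'e, edge_input) product_graph \<Rightarrow> ('v, 'e, real mat) product_graph"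
where
  "realize w G =
     \<lparr>digr = digr G, vdim = vdim G, vinput = vinput G,
      einput = (\<lambda>e. realize_input w (einput G e))\<rparr>"

definition random_arcs :: "('v, 'e, edge_input) product_graph \<Rightarrow> 'e set" where
  "random_arcs G = {e \<in> arcs (digr G). \<exists>l. einput G e = Rand l}"

definition admissible_pairings :: "('v, 'e, edge_input) product_graph \<Rightarrow> 'e set set set" where
  "admissible_pairings G =
     {\<phi>. partition_on (random_arcs G) \<phi> \<and>
         (\<forall>p\<in>\<phi>. card p = 2 \<and> (\<forall>e\<in>p. \<forall>e'\<in>p. einput G e = einput G e'))}"

inductive_set vertex_glue ::
  "('v, 'e, 'x) product_graph \<Rightarrow> 'e set set \<Rightarrow> ('v \<times> 'v) set"
  for G :: "('v, 'e, 'x) product_graph" and \<phi> :: "'e set set" where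
  heads: "\<lbrakk>p \<in> \<phi>; e \<in> p; e' \<in> p\<rbrakk> \<Longrightarrow> (head (digr G) e, head (digr G) e') \<in> vertex_glue G \<phi>"
| tails: "\<lbrakk>p \<in> \<phi>; e \<in> p; e' \<in> p\<rbrakk> \<Longrightarrow> (tail (digr G) e, tail (digr G) e') \<in> vertex_glue G \<phi>"

text \<open>
  The generated equivalence relation on the vertices: no symmetric closure is needed,
  because \<^const>\<open>vertex_glue\<close> is already symmetric.
\<close>

definition vertex_ident ::
  "('v, 'e, 'x) product_graph \<Rightarrow> 'e set set \<Rightarrow> ('v \<times> 'v) set" where
  "vertex_ident G \<phi> = (vertex_glue G \<phi>)\<^sup>* \<inter> verts (digr G) \<times> verts (digr G)"

text \<open>
  Vertices of the identified graph are classes of vertices, and arcs are classes of arcs: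
  the pairs of \<open>\<phi>\<close>, and a singleton for each arc with deterministic input. All members of
  a class of arcs have equivalent heads, so the image \<open>R `` (head D ` a)\<close> is a single
  equivalence class (likewise for tails); all members of a class of vertices have the same
  dimension and all members of a class of arcs have the same input, so each
  \<open>the_elem\<close> is applied to a singleton.
\<close>

definition identify ::
  "(nat \<Rightarrow> real) \<Rightarrow> ('v, 'e, edge_input) product_graph \<Rightarrow> 'e set set \<Rightarrow>
   ('v set, 'e set, real mat) product_graph" where
  "identify \<sigma> G \<phi> =
     (let D = digr G;
          R = vertex_ident G \<phi>;
          cdim = (\<lambda>C. the_elem (vdim G ` C));
          hd = (\<lambda>a. R `` (head D ` a));
          tl = (\<lambda>a. R `` (tail D ` a))
      in \<lparr>digr =
            \<lparr>verts = verts D // R,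
             arcs = \<phi> \<union> (\<lambda>e. {e}) ` (arcs D - random_arcs G),
             tail = tl, head = hd\<rparr>,
          vdim = cdim,
          vinput = (\<lambda>C. Matrix.vec (cdim C) (\<lambda>i. \<Prod>v\<in>C. vec_index (vinput G v) i)),
          einput = (\<lambda>a. case the_elem (einput G ` a) of
              Det A \<Rightarrow> A
            | Rand l \<Rightarrow> (\<sigma> l)\<^sup>2 \<cdot>\<^sub>m Matrix.mat (cdim (hd a)) (cdim (tl a)) (\<lambda>_. 1))\<rparr>)"

text \<open>
  The normal distribution with mean \<open>\<mu>\<close> and variance \<open>\<sigma>\<^sup>2\<close>. The degenerate
  case \<open>\<sigma> = 0\<close>, where \<^const>\<open>normal_density\<close> is the zero function, is the point mass at \<open>\<mu>\<close>.
  Only \<open>\<sigma>\<^sup>2\<close> matters, so \<open>\<sigma>\<close> may have any sign.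
\<close>

definition normal_measure :: "real \<Rightarrow> real \<Rightarrow> real measure" where
  "normal_measure \<mu> \<sigma> =
     (if \<sigma> = 0 then return borel \<mu> else density lborel (\<lambda>x. ennreal (normal_density \<mu> \<sigma> x)))"

definition mat_index :: "nat \<Rightarrow> nat \<Rightarrow> (nat \<times> nat) set" where
  "mat_index r c = {..<r} \<times> {..<c}"

text \<open>A random matrix as a random variable in the product space of its entries.\<close>

definition mat_entries :: "nat \<Rightarrow> nat \<Rightarrow> real mat \<Rightarrow> nat \<times> nat \<Rightarrow> real" where
  "mat_entries r c A = (\<lambda>p\<in>mat_index r c. A $$ p)"

definition iid_normal_mat ::
  "'a measure \<Rightarrow> nat \<Rightarrow> nat \<Rightarrow> real \<Rightarrow> ('a \<Rightarrow> real mat) \<Rightarrow> bool" where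
  "iid_normal_mat M r c \<sigma> X \<longleftrightarrow>
     (\<forall>\<omega>\<in>space M. X \<omega> \<in> carrier_mat r c) \<and>
     prob_space.indep_vars M (\<lambda>_. borel) (\<lambda>p \<omega>. X \<omega> $$ p) (mat_index r c) \<and>
     (\<forall>p\<in>mat_index r c. distr M borel (\<lambda>\<omega>. X \<omega> $$ p) = normal_measure 0 \<sigma>)"

lemma wf_product_graph_realize:
  assumes "wf_product_graph (input_shape Nr Nc) G" "\<And>l. w l \<in> carrier_mat (Nr l) (Nc l)"
  shows "wf_product_graph mat_shape (realize w G)"
proof -
  have "mat_shape (realize_input w x) = input_shape Nr Nc x" for x
    using assms(2) by (cases x) (auto simp: mat_shape_def)
  then show ?thesis
    using assms(1) by (simp add: wf_product_graph_def realize_def)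
qed

lemma equiv_rtrancl_Int:
  assumes "sym S"
  shows "equiv V (S\<^sup>* \<inter> V \<times> V)"
proof (rule equivI)
  show "sym (S\<^sup>* \<inter> V \<times> V)"
    by (intro sym_Int sym_rtrancl assms symI) simp
  show "trans (S\<^sup>* \<inter> V \<times> V)"
    by (intro trans_Int trans_rtrancl transI) simp
qed (simp_all add: refl_on_def)

lemma equiv_vertex_ident: "equiv (verts (digr G)) (vertex_ident G \<phi>)"
proof -
  have "sym (vertex_glue G \<phi>)"
  proof (rule symI)
    fix u v assume "(u, v) \<in> vertex_glue G \<phi>"
    then show "(v, u) \<in> vertex_glue G \<phi>"
      by cases (auto intro: vertex_glue.intros)
  qed
  then show ?thesis unfolding vertex_ident_def by (rule equiv_rtrancl_Int)
qed

lemma admissible_pairingsD: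
  assumes "\<phi> \<in> admissible_pairings G" "p \<in> \<phi>"
  shows "p \<subseteq> random_arcs G" "p \<noteq> {}" "\<And>e e'. e \<in> p \<Longrightarrow> e' \<in> p \<Longrightarrow> einput G e = einput G e'"
  using assms unfolding admissible_pairings_def partition_on_def by blast+

lemma vertex_ident_vdim:
  assumes wf: "wf_product_graph (input_shape Nr Nc) G" and "\<phi> \<in> admissible_pairings G"
    and "(u, v) \<in> vertex_ident G \<phi>"
  shows "vdim G u = vdim G v"
proof -
  let ?D = "digr G"
  have shp: "input_shape Nr Nc (einput G e) = (vdim G (head ?D e), vdim G (tail ?D e))"
    if "e \<in> arcs ?D" for e
    using wf that unfolding wf_product_graph_def by blast
  have key: "vdim G (head ?D e) = vdim G (head ?D e') \<and> vdim G (tail ?D e) = vdim G (tail ?D e')"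
    if "p \<in> \<phi>" "e \<in> p" "e' \<in> p" for p e e'
  proof -
    note p = admissible_pairingsD[OF assms(2) that(1)]
    have "e \<in> arcs ?D" "e' \<in> arcs ?D"
      using p(1) that(2,3) unfolding random_arcs_def by blast+
    moreover have "einput G e = einput G e'" using p(3) that(2,3) .
    ultimately show ?thesis using shp[of e] shp[of e'] by simp
  qed
  have step: "vdim G x = vdim G y" if "(x, y) \<in> vertex_glue G \<phi>" for x y
    using that
  proof cases
    case (heads p e e')
    with key[OF heads(3-5)] show ?thesis by simp
  next
    case (tails p e e')
    with key[OF tails(3-5)] show ?thesis by simp
  qed
  from assms(3) have "(u, v) \<in> (vertex_glue G \<phi>)\<^sup>*" by (simp add: vertex_ident_def)
  then show ?thesis by (induction rule: rtrancl_induct) (simp, metis step)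
qed

lemma wf_product_graph_identify:
  assumes wf: "wf_product_graph (input_shape Nr Nc) G" and \<phi>: "\<phi> \<in> admissible_pairings G"
  shows "wf_product_graph mat_shape (identify \<sigma> G \<phi>)"
proof -
  let ?D = "digr G" and ?R = "vertex_ident G \<phi>" and ?G = "identify \<sigma> G \<phi>"
  let ?hd = "\<lambda>a. ?R `` (head ?D ` a)" and ?tl = "\<lambda>a. ?R `` (tail ?D ` a)"
  interpret D: fin_digraph ?D using wf by (simp add: wf_product_graph_def)
  have eq: "equiv (verts ?D) ?R" by (rule equiv_vertex_ident)
  have sel: "verts (digr ?G) = verts ?D // ?R"
    "arcs (digr ?G) = \<phi> \<union> (\<lambda>e. {e}) ` (arcs ?D - random_arcs G)"
    "head (digr ?G) = ?hd" "tail (digr ?G) = ?tl"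
    "vdim ?G = (\<lambda>C. the_elem (vdim G ` C))"
    by (auto simp: identify_def Let_def)
  have sub: "a \<subseteq> arcs ?D" "a \<noteq> {}" "\<And>e e'. e \<in> a \<Longrightarrow> e' \<in> a \<Longrightarrow> einput G e = einput G e'"
    if "a \<in> arcs (digr ?G)" for a
  proof -
    from that consider "a \<in> \<phi>" | e where "a = {e}" "e \<in> arcs ?D" unfolding sel by blast
    then show "a \<subseteq> arcs ?D" "a \<noteq> {}" "\<And>e e'. e \<in> a \<Longrightarrow> e' \<in> a \<Longrightarrow> einput G e = einput G e'"
      using admissible_pairingsD[OF \<phi>] unfolding random_arcs_def by (cases; blast)+
  qed
  have cls: "?hd a = ?R `` {head ?D e}" "?tl a = ?R `` {tail ?D e}"
    if a: "a \<in> arcs (digr ?G)" and e: "e \<in> a" for a e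
  proof -
    have "(head ?D e, head ?D e') \<in> ?R \<and> (tail ?D e, tail ?D e') \<in> ?R" if e': "e' \<in> a" for e'
    proof (cases "a \<in> \<phi>")
      case True
      with e e' have
        "(head ?D e, head ?D e') \<in> vertex_glue G \<phi>"
        "(tail ?D e, tail ?D e') \<in> vertex_glue G \<phi>"
        by (auto intro: vertex_glue.intros)
      moreover have "e \<in> arcs ?D" "e' \<in> arcs ?D" using sub(1)[OF a] e e' by auto
      ultimately show ?thesis
        by (simp add: vertex_ident_def r_into_rtrancl)
    next
      case False
      with a e e' have "e' = e" by (auto simp: sel)
      then show ?thesis using e sub(1)[OF a] equiv_class_self[OF eq] by auto
    qed
    then have "?R `` {head ?D e'} = ?R `` {head ?D e}" "?R `` {tail ?D e'} = ?R `` {tail ?D e}"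
      if "e' \<in> a" for e'
      using that equiv_class_eq[OF eq] by metis+
    then show "?hd a = ?R `` {head ?D e}" "?tl a = ?R `` {tail ?D e}" using e by blast+
  qed
  have cd: "the_elem (vdim G ` (?R `` {v})) = vdim G v" if "v \<in> verts ?D" for v
  proof -
    have "vdim G ` (?R `` {v}) = {vdim G v}"
    proof (intro equalityI subsetI)
      fix x assume "x \<in> vdim G ` (?R `` {v})"
      then obtain u where "(v, u) \<in> ?R" "x = vdim G u" by blast
      with vertex_ident_vdim[OF wf \<phi>] show "x \<in> {vdim G v}" by simp
    next
      fix x assume "x \<in> {vdim G v}"
      with equiv_class_self[OF eq that] show "x \<in> vdim G ` (?R `` {v})" by blast
    qed
    then show ?thesis by simp
  qed
  have dim: "the_elem (vdim G ` C) > 0" if "C \<in> verts ?D // ?R" for C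
    using that cd wf by (auto simp: wf_product_graph_def elim!: quotientE)
  have fin: "fin_digraph (digr ?G)"
  proof unfold_locales
    fix a assume a: "a \<in> arcs (digr ?G)"
    then obtain e where "e \<in> a" "e \<in> arcs ?D" using sub by blast
    then show "tail (digr ?G) a \<in> verts (digr ?G)" "head (digr ?G) a \<in> verts (digr ?G)"
      using cls[OF a] by (auto simp: sel intro!: quotientI)
  next
    show "finite (verts (digr ?G))"
      unfolding sel by (intro finite_quotient D.finite_verts) (simp add: vertex_ident_def)
    show "finite (arcs (digr ?G))"
      by (rule finite_subset[of _ "Pow (arcs ?D)"]) (use sub in auto)
  qed
  have "mat_shape (einput ?G a) =
      (vdim ?G (head (digr ?G) a), vdim ?G (tail (digr ?G) a))"
    if a: "a \<in> arcs (digr ?G)" for a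
  proof -
    obtain e where e: "e \<in> a" "e \<in> arcs ?D" using sub[OF a] by blast
    have "einput G ` a = {einput G e}" using sub(3)[OF a] e by blast
    moreover have "input_shape Nr Nc (einput G e) = (vdim G (head ?D e), vdim G (tail ?D e))"
      using wf e by (auto simp: wf_product_graph_def)
    ultimately show ?thesis using cls[OF a e(1)] cd e
      by (cases "einput G e") (auto simp: identify_def Let_def mat_shape_def)
  qed
  then show ?thesis
    using fin dim by (auto simp: wf_product_graph_def sel) (auto simp: identify_def Let_def)
qed

end

theory Submission
  imports Defs
begin

text \<open>
  For a fixed index assignment \<open>i\<close> the random factors of the value are jointly independent
  centred Gaussians, possibly repeated, so Isserlis' theorem turns their expected product into
  a sum over all pairings of the random arcs. A pair contributes \<open>\<sigma> l\<^sup>2\<close> if both arcs pick the same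
  entry of the same \<open>W l\<close> and 0 otherwise. Hence inadmissible pairings vanish, and for an
  admissible \<open>\<phi>\<close> only those \<open>i\<close> survive that are constant on the classes of \<open>vertex_ident G \<phi>\<close>;
  these are the index assignments of the identified graph.

  Isserlis' theorem itself follows by induction from the recursion
  \<open>E (X a * P) = (\<Sum>b. E (X a * X b) * E (P / X b))\<close> for a monomial \<open>P\<close> with factors \<open>X b\<close>, which
  by independence reduces to the moment recursion \<open>E (X ^ (n + 2)) = (n + 1) * s\<^sup>2 * E (X ^ n)\<close>.
\<close>

section \<open>Moments of the centred normal distribution\<close>

text \<open>For \<open>s = 0\<close> the measure is the point mass at 0 and both sides of the
  recursion vanish. Otherwise odd moments vanish by symmetry, and the recursion for even
  \<open>n\<close> is read off from the closed formula for even moments.\<close>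

lemma normal_measure_0_moments:
  shows integrable_normal_measure_power: "integrable (normal_measure 0 s) (\<lambda>x. x ^ n)"
    and integral_normal_measure_id: "(\<integral>x. x \<partial>normal_measure 0 s) = 0"
    and integral_normal_measure_power_Suc_Suc:
      "(\<integral>x. x ^ Suc (Suc n) \<partial>normal_measure 0 s) =
         real (Suc n) * s\<^sup>2 * (\<integral>x. x ^ n \<partial>normal_measure 0 s)"
proof -
  have "integrable (normal_measure 0 s) (\<lambda>x. x ^ n) \<and>
    (\<integral>x. x \<partial>normal_measure 0 s) = 0 \<and>
    (\<integral>x. x ^ Suc (Suc n) \<partial>normal_measure 0 s) =
         real (Suc n) * s\<^sup>2 * (\<integral>x. x ^ n \<partial>normal_measure 0 s)"
  proof (cases "s = 0")
    case True
    interpret return: prob_space "return borel (0::real)"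
      by (rule prob_space_return) simp
    have "integrable (return borel 0) (\<lambda>x::real. x ^ n)"
      by (rule integrableI_bounded) (auto simp: nn_integral_return)
    then show ?thesis using True by (simp add: normal_measure_def integral_return)
  next
    case False
    \<comment> \<open>\<open>s\<close> may be negative, whereas the moment formulas assume a
      positive standard deviation. The density depends on \<open>s\<close> only through its square,
      so the absolute value serves equally well.\<close>
    define t where "t = \<bar>s\<bar>"
    have t: "t > 0" "s\<^sup>2 = t\<^sup>2" using False by (auto simp: t_def)
    have meas: "normal_measure 0 s = density lborel (\<lambda>x. ennreal (normal_density 0 t x))"
      using False t by (simp add: normal_measure_def normal_density_def)
    have int: "(\<integral>x. x ^ m \<partial>normal_measure 0 s) = (\<integral>x. normal_density 0 t x * x ^ m \<partial>lborel)" for m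
      unfolding meas by (subst integral_density) auto
    have odd: "(\<integral>x. x ^ m \<partial>normal_measure 0 s) = 0" if "odd m" for m
    proof -
      from that obtain k where "m = 2 * k + 1" by (rule oddE)
      then show ?thesis unfolding int using integral_normal_moment_odd[OF t(1), of 0 k] by simp
    qed
    have even: "(\<integral>x. x ^ (2 * k) \<partial>normal_measure 0 s) = fact (2 * k) / ((2 / t\<^sup>2) ^ k * fact k)" for k
      unfolding int using integral_normal_moment_even[OF t(1), of 0 k] by simp
    have "(\<integral>x. x ^ Suc (Suc n) \<partial>normal_measure 0 s) =
         real (Suc n) * s\<^sup>2 * (\<integral>x. x ^ n \<partial>normal_measure 0 s)"
    proof (cases "even n")
      case True
      then obtain k where k: "n = 2 * k" by (auto elim: evenE)
      \<comment> \<open>The factor \<open>2 * real k + 2\<close> cancels against the new 2 in the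
        power and the new factor \<open>k + 1\<close> of \<open>fact (Suc k)\<close>, leaving
        \<open>2 * real k + 1 = real (Suc n)\<close>.\<close>
      have fact: "(fact (2 * Suc k) :: real) = (2 * real k + 2) * (2 * real k + 1) * fact (2 * k)"
        by (simp add: algebra_simps)
      have "fact (2 * Suc k) / ((2 / t\<^sup>2) ^ Suc k * fact (Suc k)) =
          (2 * real k + 1) * t\<^sup>2 * (fact (2 * k) / ((2 / t\<^sup>2) ^ k * fact k))"
        unfolding fact using t(1) by (simp add: divide_simps)
      then show ?thesis using even[of "Suc k"] even[of k] t(2) k by simp
    next
      case False
      then show ?thesis by (simp add: odd del: power_Suc)
    qed
    moreover have "integrable (normal_measure 0 s) (\<lambda>x. x ^ n)"
      unfolding meas using integrable_normal_moment[OF t(1), of 0 n]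
      by (subst integrable_density) auto
    ultimately show ?thesis using odd[of 1] by simp
  qed
  then show "integrable (normal_measure 0 s) (\<lambda>x. x ^ n)"
    "(\<integral>x. x \<partial>normal_measure 0 s) = 0"
    "(\<integral>x. x ^ Suc (Suc n) \<partial>normal_measure 0 s) =
         real (Suc n) * s\<^sup>2 * (\<integral>x. x ^ n \<partial>normal_measure 0 s)"
    by blast+
qed

section \<open>Pairings of a finite set and their recursion\<close>

definition pairings :: "'a set \<Rightarrow> 'a set set set" where
  "pairings S = {\<phi>. partition_on S \<phi> \<and> (\<forall>p\<in>\<phi>. card p = 2)}"

lemma pairingsD:
  assumes "\<phi> \<in> pairings S" "p \<in> \<phi>"
  shows "p \<subseteq> S" "card p = 2"
proof -
  have "\<Union>\<phi> = S" using assms(1) by (simp add: pairings_def partition_on_def)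
  then show "p \<subseteq> S" using Union_upper[OF assms(2)] by simp
  show "card p = 2" using assms by (simp add: pairings_def)
qed

lemma pairings_empty: "pairings {} = {{}}"
  by (auto simp: pairings_def partition_on_empty)

lemma finite_pairings: "finite S \<Longrightarrow> finite (pairings S)"
  by (rule finite_subset[of _ "Pow (Pow S)"]) (auto simp: pairings_def partition_on_def)

text \<open>The block of \<open>a\<close> has the form \<open>{a, b}\<close> for some
  \<open>b\<close> in \<open>S\<close>, and deleting it leaves a pairing of the remaining elements.
  Conversely such a block can be added to any pairing of \<open>S - {b}\<close>.\<close>

lemma pairings_insert:
  assumes "a \<notin> S"
  shows "pairings (insert a S) = (\<Union>b\<in>S. insert {a, b} ` pairings (S - {b}))"
proof (intro equalityI subsetI)
  fix \<phi> assume \<phi>: "\<phi> \<in> pairings (insert a S)"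
  then obtain p where p: "p \<in> \<phi>" "a \<in> p" by (auto simp: pairings_def partition_on_def)
  moreover have "card p = 2" using \<phi> p by (simp add: pairings_def)
  ultimately obtain b where b: "p = {a, b}" "a \<noteq> b" by (auto simp: card_2_iff doubleton_eq_iff)
  have "b \<in> S" using \<phi> p b by (auto simp: pairings_def partition_on_def)
  have "disjnt p (\<Union>(\<phi> - {p}))"
    using \<phi> p by (fastforce simp: pairings_def partition_on_def disjoint_def disjnt_def)
  moreover have "partition_on (insert a S) (insert p (\<phi> - {p}))"
    using \<phi> p by (simp add: pairings_def insert_absorb)
  ultimately have "partition_on (insert a S - p) (\<phi> - {p})"
    by (simp only: partition_on_insert)
  moreover have "insert a S - p = S - {b}" using assms b by auto
  ultimately have "\<phi> - {p} \<in> pairings (S - {b})" using \<phi> by (simp add: pairings_def)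
  moreover have "\<phi> = insert {a, b} (\<phi> - {p})" using p b by auto
  ultimately show "\<phi> \<in> (\<Union>b\<in>S. insert {a, b} ` pairings (S - {b}))" using \<open>b \<in> S\<close> by blast
next
  fix \<phi> assume "\<phi> \<in> (\<Union>b\<in>S. insert {a, b} ` pairings (S - {b}))"
  then obtain b \<psi> where b: "b \<in> S" "\<psi> \<in> pairings (S - {b})" "\<phi> = insert {a, b} \<psi>" by blast
  have "\<Union>\<psi> = S - {b}" using b by (auto simp: pairings_def partition_on_def)
  with assms have "disjnt {a, b} (\<Union>\<psi>)" by auto
  moreover have "insert a S - {a, b} = S - {b}" using assms by auto
  moreover have "a \<noteq> b" using assms b by auto
  ultimately show "\<phi> \<in> pairings (insert a S)"
    using b by (simp add: pairings_def partition_on_insert)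
qed

text \<open>Summing over the partner \<open>b\<close> of \<open>a\<close> counts each pairing once:
  no pairing of \<open>S - {b}\<close> has a block containing \<open>a\<close>, so \<open>b\<close>
  and the rest of the pairing can both be recovered. The right-hand side has the same shape as the
  recursion for Gaussian products in \<open>expectation_prod_normal_family_insert\<close>.\<close>

lemma sum_pairings_insert:
  fixes c :: "'a set \<Rightarrow> 'b::comm_semiring_1"
  assumes "finite S" "a \<notin> S"
  shows "(\<Sum>\<phi>\<in>pairings (insert a S). \<Prod>p\<in>\<phi>. c p) =
    (\<Sum>b\<in>S. c {a, b} * (\<Sum>\<phi>\<in>pairings (S - {b}). \<Prod>p\<in>\<phi>. c p))"
proof -
  have notin: "{a, b'} \<notin> \<psi>" if "\<psi> \<in> pairings (S - {b})" for \<psi> b b'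
  proof
    assume "{a, b'} \<in> \<psi>"
    then have "a \<in> \<Union>\<psi>" by blast
    also have "\<Union>\<psi> = S - {b}" using that by (simp add: pairings_def partition_on_def)
    finally show False using assms(2) by simp
  qed
  have fin: "finite \<psi>" if "\<psi> \<in> pairings (S - {b})" for \<psi> b
    using that assms(1) finite_elements[of "S - {b}" \<psi>] by (simp add: pairings_def)
  have "(\<Sum>\<phi>\<in>pairings (insert a S). \<Prod>p\<in>\<phi>. c p) =
    (\<Sum>b\<in>S. \<Sum>\<phi>\<in>insert {a, b} ` pairings (S - {b}). \<Prod>p\<in>\<phi>. c p)"
    unfolding pairings_insert[OF assms(2)]
  proof (rule sum.UNION_disjoint)
    show "\<forall>b\<in>S. \<forall>b'\<in>S. b \<noteq> b' \<longrightarrow>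
      insert {a, b} ` pairings (S - {b}) \<inter> insert {a, b'} ` pairings (S - {b'}) = {}"
    proof (intro ballI impI)
      fix b b' assume "b \<in> S" "b' \<in> S" "b \<noteq> b'"
      then have "{a, b} \<noteq> {a, b'}" by (auto simp: doubleton_eq_iff)
      then have "insert {a, b} \<psi> \<noteq> insert {a, b'} \<psi>'" if "\<psi>' \<in> pairings (S - {b'})" for \<psi> \<psi>'
        using notin[OF that, of b] by (metis insertE insertI1)
      then show "insert {a, b} ` pairings (S - {b}) \<inter> insert {a, b'} ` pairings (S - {b'}) = {}"
        by (auto simp only: image_iff disjoint_iff)
    qed
  qed (simp_all add: assms finite_pairings)
  also have "\<dots> = (\<Sum>b\<in>S. c {a, b} * (\<Sum>\<phi>\<in>pairings (S - {b}). \<Prod>p\<in>\<phi>. c p))"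
  proof (rule sum.cong[OF refl])
    fix b assume "b \<in> S"
    have "inj_on (insert {a, b}) (pairings (S - {b}))"
      by (intro inj_onI) (metis insert_ident notin)
    then have "(\<Sum>\<phi>\<in>insert {a, b} ` pairings (S - {b}). \<Prod>p\<in>\<phi>. c p) =
        (\<Sum>\<phi>\<in>pairings (S - {b}). \<Prod>p\<in>insert {a, b} \<phi>. c p)"
      by (simp add: sum.reindex)
    also have "\<dots> = (\<Sum>\<phi>\<in>pairings (S - {b}). c {a, b} * (\<Prod>p\<in>\<phi>. c p))"
      by (intro sum.cong refl prod.insert fin notin)
    finally show "(\<Sum>\<phi>\<in>insert {a, b} ` pairings (S - {b}). \<Prod>p\<in>\<phi>. c p) =
        c {a, b} * (\<Sum>\<phi>\<in>pairings (S - {b}). \<Prod>p\<in>\<phi>. c p)"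
      by (simp add: sum_distrib_left)
  qed
  finally show ?thesis .
qed

text \<open>Collects repeated factors, so that independence can be applied to powers of distinct
  variables. \<open>K\<close> may exceed the image of \<open>T\<close>; the extra indices then get
  exponent 0.\<close>

lemma prod_compose_eq_prod_power:
  fixes f :: "'b \<Rightarrow> 'c::comm_monoid_mult"
  assumes "finite T" "finite K" "k ` T \<subseteq> K"
  shows "(\<Prod>e\<in>T. f (k e)) = (\<Prod>i\<in>K. f i ^ card {e\<in>T. k e = i})"
  by (subst prod.group[OF assms, symmetric], rule prod.cong[OF refl])
     (simp cong: conj_cong)

section \<open>Joint independence from two levels of independence\<close>

context prob_space
begin

text \<open>Events on finitely many coordinates are grouped by their first index \<open>l\<close>.
  Each group is a single cylinder event for \<open>Y l\<close>, so independence across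
  \<open>l\<close> splits the probability into groups, and independence inside each family splits
  every group.\<close>

lemma indep_vars_Sigma:
  assumes out: "indep_vars (\<lambda>l. PiM (I l) (N l)) Y L"
    and ins: "\<And>l. l \<in> L \<Longrightarrow> indep_vars (N l) (\<lambda>p \<omega>. Y l \<omega> p) (I l)"
  shows "indep_vars (\<lambda>(l, p). N l p) (\<lambda>(l, p) \<omega>. Y l \<omega> p) (Sigma L I)"
  unfolding indep_vars_def2
proof
  have rv: "random_variable (N l p) (\<lambda>\<omega>. Y l \<omega> p)" if "l \<in> L" "p \<in> I l" for l p
    using ins[OF that(1)] that(2) by (simp add: indep_vars_def)
  then show "\<forall>i\<in>Sigma L I. random_variable (case i of (l, p) \<Rightarrow> N l p) (case i of (l, p) \<Rightarrow> \<lambda>\<omega>. Y l \<omega> p)"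
    by auto
  let ?F = "\<lambda>i. {(case i of (l, p) \<Rightarrow> \<lambda>\<omega>. Y l \<omega> p) -` A \<inter> space M | A. A \<in> sets (case i of (l, p) \<Rightarrow> N l p)}"
  show "indep_sets ?F (Sigma L I)"
  proof (rule indep_setsI)
    fix i assume "i \<in> Sigma L I"
    then obtain l p where "i = (l, p)" "l \<in> L" "p \<in> I l" by blast
    with measurable_sets[OF rv] show "?F i \<subseteq> events" by auto
  next
    fix A J assume J: "J \<noteq> {}" "J \<subseteq> Sigma L I" "finite J" and A: "\<forall>j\<in>J. A j \<in> ?F j"
    have "\<forall>j\<in>J. \<exists>B. B \<in> sets (case j of (l, p) \<Rightarrow> N l p) \<and>
        A j = (case j of (l, p) \<Rightarrow> \<lambda>\<omega>. Y l \<omega> p) -` B \<inter> space M"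
      using A by blast
    then obtain B where B: "\<forall>j\<in>J. B j \<in> sets (case j of (l, p) \<Rightarrow> N l p) \<and>
        A j = (case j of (l, p) \<Rightarrow> \<lambda>\<omega>. Y l \<omega> p) -` B j \<inter> space M"
      by (rule bchoice[THEN exE])
    \<comment> \<open>\<open>L'\<close> collects the first indices occurring in \<open>J\<close>,
      and \<open>K l\<close> is the slice of \<open>J\<close> over \<open>l\<close>.\<close>
    define K where "K l = {p. (l, p) \<in> J}" for l
    define L' where "L' = fst ` J"
    have JS: "J = Sigma L' K" by (force simp: K_def L'_def)
    have L': "finite L'" "L' \<noteq> {}" "L' \<subseteq> L" using J by (auto simp: L'_def)
    have "K l \<subseteq> snd ` J" for l by (force simp: K_def)
    then have K: "finite (K l)" for l by (rule finite_subset) (use J(3) in simp)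
    have KI: "K l \<subseteq> I l" for l using J by (auto simp: K_def)
    \<comment> \<open>An empty slice would make the intersection over \<open>K l\<close> the whole
      type instead of \<open>space M\<close>.\<close>
    have Kne: "K l \<noteq> {}" if "l \<in> L'" for l using that by (auto simp: K_def L'_def)
    have BA: "B (l, p) \<in> sets (N l p)" "A (l, p) = (\<lambda>\<omega>. Y l \<omega> p) -` B (l, p) \<inter> space M"
      if "l \<in> L'" "p \<in> K l" for l p
      using B JS that by (force, force)
    \<comment> \<open>The cylinder over \<open>K l\<close> whose preimage under \<open>Y l\<close>
      is the intersection of the events with first index \<open>l\<close>.\<close>
    define C where "C l = prod_emb (I l) (N l) (K l) (\<Pi>\<^sub>E p\<in>K l. B (l, p))" for l
    have C: "C l \<in> sets (PiM (I l) (N l))" if "l \<in> L'" for l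
      unfolding C_def using K KI BA that by (intro sets_PiM_I) auto
    have YC: "Y l -` C l \<inter> space M = (\<Inter>p\<in>K l. A (l, p))" if l: "l \<in> L'" for l
    proof -
      \<comment> \<open>Measurability places \<open>Y l \<omega>\<close> in the product space, which
        is the side condition built into \<open>prod_emb\<close>.\<close>
      have "Y l \<in> measurable M (PiM (I l) (N l))"
        using out L'(3) l unfolding indep_vars_def by blast
      then have "Y l \<omega> \<in> space (PiM (I l) (N l))" if "\<omega> \<in> space M" for \<omega>
        using that by (rule measurable_space)
      moreover have "(\<Inter>p\<in>K l. A (l, p)) = {\<omega>\<in>space M. \<forall>p\<in>K l. Y l \<omega> p \<in> B (l, p)}"
        using BA(2)[OF l] Kne[OF l] by auto
      ultimately show ?thesis
        using KI[of l] by (auto simp: C_def prod_emb_def space_PiM PiE_iff)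
    qed
    have "(\<Inter>j\<in>Sigma L' K. A j) = (\<Inter>l\<in>L'. \<Inter>p\<in>K l. A (l, p))"
      by (auto simp only: INT_iff mem_Sigma_iff split_paired_Ball_Sigma)
    then have "(\<Inter>j\<in>J. A j) = (\<Inter>l\<in>L'. Y l -` C l \<inter> space M)"
      using YC by (simp add: JS cong: INF_cong)
    then have "prob (\<Inter>j\<in>J. A j) = (\<Prod>l\<in>L'. prob (Y l -` C l \<inter> space M))"
      using indep_varsD[OF out L'(2,1,3), of C] C by simp
    also have "\<dots> = (\<Prod>l\<in>L'. \<Prod>p\<in>K l. prob (A (l, p)))"
    proof (rule prod.cong[OF refl])
      fix l assume l: "l \<in> L'"
      have "(\<Inter>p\<in>K l. A (l, p)) = (\<Inter>p\<in>K l. (\<lambda>\<omega>. Y l \<omega> p) -` B (l, p) \<inter> space M)"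
        using BA(2)[OF l] by (simp cong: INF_cong)
      also have "prob \<dots> = (\<Prod>p\<in>K l. prob ((\<lambda>\<omega>. Y l \<omega> p) -` B (l, p) \<inter> space M))"
        using l L'(3) by (intro indep_varsD[OF ins Kne[OF l] K KI] BA(1)) auto
      also have "\<dots> = (\<Prod>p\<in>K l. prob (A (l, p)))" using BA(2)[OF l] by simp
      finally show "prob (Y l -` C l \<inter> space M) = (\<Prod>p\<in>K l. prob (A (l, p)))"
        using YC[OF l] by simp
    qed
    also have "\<dots> = (\<Prod>j\<in>J. prob (A j))"
      unfolding JS by (subst prod.Sigma) (simp_all add: L'(1) K)
    finally show "prob (\<Inter>j\<in>J. A j) = (\<Prod>j\<in>J. prob (A j))" .
  qed
qed

section \<open>Isserlis' theorem for independent centred Gaussians with repetitions\<close>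

context
  fixes X :: "'i \<Rightarrow> 'a \<Rightarrow> real" and I :: "'i set" and s :: "'i \<Rightarrow> real"
  assumes indep: "indep_vars (\<lambda>_. borel) X I"
    and normal: "\<And>i. i \<in> I \<Longrightarrow> distr M borel (X i) = normal_measure 0 (s i)"
begin

lemma normal_family_power:
  assumes "i \<in> I"
  shows "integrable M (\<lambda>\<omega>. X i \<omega> ^ n)"
    and "expectation (\<lambda>\<omega>. X i \<omega> ^ n) = (\<integral>x. x ^ n \<partial>normal_measure 0 (s i))"
proof -
  have [measurable]: "random_variable borel (X i)" using indep assms by (auto simp: indep_vars_def)
  show "integrable M (\<lambda>\<omega>. X i \<omega> ^ n)"
    using integrable_normal_measure_power[of "s i" n] unfolding normal[OF assms, symmetric]
    by (subst (asm) integrable_distr_eq) auto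
  show "expectation (\<lambda>\<omega>. X i \<omega> ^ n) = (\<integral>x. x ^ n \<partial>normal_measure 0 (s i))"
    unfolding normal[OF assms, symmetric] by (subst integral_distr) auto
qed

text \<open>Powers of independent variables are again independent, so the expectation of a monomial
  factors into one-dimensional moments.\<close>

lemma normal_family_mixed_moment:
  assumes "finite K" "K \<subseteq> I"
  shows "integrable M (\<lambda>\<omega>. \<Prod>i\<in>K. X i \<omega> ^ n i)"
    and "expectation (\<lambda>\<omega>. \<Prod>i\<in>K. X i \<omega> ^ n i) =
      (\<Prod>i\<in>K. \<integral>x. x ^ n i \<partial>normal_measure 0 (s i))"
proof -
  have ind: "indep_vars (\<lambda>_. borel) (\<lambda>i \<omega>. X i \<omega> ^ n i) K"
    by (rule indep_vars_compose2[OF indep_vars_subset[OF indep assms(2)]]) simp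
  show "integrable M (\<lambda>\<omega>. \<Prod>i\<in>K. X i \<omega> ^ n i)"
    using assms by (intro indep_vars_integrable[OF _ ind] normal_family_power) auto
  show "expectation (\<lambda>\<omega>. \<Prod>i\<in>K. X i \<omega> ^ n i) =
      (\<Prod>i\<in>K. \<integral>x. x ^ n i \<partial>normal_measure 0 (s i))"
    using assms
    by (subst indep_vars_lebesgue_integral[OF _ ind])
       (auto intro!: normal_family_power prod.cong)
qed

lemma integrable_prod_normal_family:
  assumes "finite T" "k ` T \<subseteq> I"
  shows "integrable M (\<lambda>\<omega>. \<Prod>e\<in>T. X (k e) \<omega>)"
  using normal_family_mixed_moment(1)[of "k ` T"] assms
  by (simp add: prod_compose_eq_prod_power[OF assms(1) finite_imageI[OF assms(1)] order.refl,
        where f="\<lambda>i. X i _"])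

text \<open>Adding the factor \<open>a\<close> changes only the exponent of the variable
  \<open>X (k a)\<close>. The moment recursion then produces as many equal terms as there are
  \<open>b\<close> in \<open>S\<close> with \<open>k b = k a\<close>, and each such term is the
  expectation with \<open>b\<close> left out.\<close>

lemma expectation_prod_normal_family_insert:
  assumes S: "finite S" "a \<notin> S" "k ` insert a S \<subseteq> I"
  shows "expectation (\<lambda>\<omega>. \<Prod>e\<in>insert a S. X (k e) \<omega>) =
    (\<Sum>b\<in>S. (if k a = k b then (s (k a))\<^sup>2 else 0) * expectation (\<lambda>\<omega>. \<Prod>e\<in>S - {b}. X (k e) \<omega>))"
proof -
  define K where "K = k ` insert a S"
  define m where "m i n = (\<integral>x. x ^ n \<partial>normal_measure 0 (s i))" for i n
  have K: "finite K" "K \<subseteq> I" "k a \<in> K" using S by (auto simp: K_def)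
  \<comment> \<open>The same \<open>K\<close> serves for every subset \<open>T\<close>, so the
    expectations for \<open>insert a S\<close> and for \<open>S - {b}\<close> become products over a
    common index set and differ only in exponents.\<close>
  have F: "expectation (\<lambda>\<omega>. \<Prod>e\<in>T. X (k e) \<omega>) = (\<Prod>i\<in>K. m i (card {e\<in>T. k e = i}))"
    if T: "T \<subseteq> insert a S" for T
  proof -
    have "finite T" "k ` T \<subseteq> K" using T S by (auto simp: K_def intro: finite_subset)
    then show ?thesis
      unfolding m_def using K normal_family_mixed_moment(2)[of K "\<lambda>i. card {e\<in>T. k e = i}"]
      by (simp add: prod_compose_eq_prod_power[of T K k, where f="\<lambda>i. X i _"])
  qed
  define B where "B = {b\<in>S. k b = k a}"
  define rest where "rest = (\<Prod>i\<in>K - {k a}. m i (card {e\<in>S. k e = i}))"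
  have finB: "finite B" using S by (simp add: B_def)
  have "expectation (\<lambda>\<omega>. \<Prod>e\<in>insert a S. X (k e) \<omega>) = m (k a) (card {e\<in>insert a S. k e = k a}) *
      (\<Prod>i\<in>K - {k a}. m i (card {e\<in>insert a S. k e = i}))"
    using F[of "insert a S"] K by (simp add: prod.remove)
  also have "{e\<in>insert a S. k e = k a} = insert a B" by (auto simp: B_def)
  also have "card (insert a B) = Suc (card B)" using S finB by (simp add: B_def)
  also have "(\<Prod>i\<in>K - {k a}. m i (card {e\<in>insert a S. k e = i})) = rest"
    unfolding rest_def by (intro prod.cong refl arg_cong[where f="\<lambda>A. m _ (card A)"]) auto
  \<comment> \<open>If \<open>B\<close> is empty, the truncated \<open>card B - 1\<close> is
    harmless because of the factor \<open>real (card B) = 0\<close>; the left side is then the mean,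
    which is 0.\<close>
  also have "m (k a) (Suc (card B)) = real (card B) * (s (k a))\<^sup>2 * m (k a) (card B - 1)"
  proof (cases "card B")
    case 0
    then show ?thesis by (simp add: m_def integral_normal_measure_id)
  next
    case (Suc n)
    then show ?thesis by (simp add: m_def integral_normal_measure_power_Suc_Suc del: power_Suc)
  qed
  also have "real (card B) * (s (k a))\<^sup>2 * m (k a) (card B - 1) * rest =
      (\<Sum>b\<in>B. (s (k a))\<^sup>2 * (m (k a) (card B - 1) * rest))"
    by (simp add: algebra_simps)
  also have "\<dots> = (\<Sum>b\<in>B. (s (k a))\<^sup>2 * expectation (\<lambda>\<omega>. \<Prod>e\<in>S - {b}. X (k e) \<omega>))"
  proof (intro sum.cong refl arg_cong[where f="\<lambda>x. (s (k a))\<^sup>2 * x"])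
    fix b assume b: "b \<in> B"
    have "{e\<in>S - {b}. k e = k a} = B - {b}" by (auto simp: B_def)
    then have "card {e\<in>S - {b}. k e = k a} = card B - 1" using b finB by simp
    \<comment> \<open>Since \<open>k b = k a\<close>, leaving out \<open>b\<close> does not affect
      the exponents of the other variables.\<close>
    moreover have "(\<Prod>i\<in>K - {k a}. m i (card {e\<in>S - {b}. k e = i})) = rest"
      unfolding rest_def using b
      by (intro prod.cong refl arg_cong[where f="\<lambda>A. m _ (card A)"]) (auto simp: B_def)
    ultimately show "m (k a) (card B - 1) * rest = expectation (\<lambda>\<omega>. \<Prod>e\<in>S - {b}. X (k e) \<omega>)"
      using F[of "S - {b}"] K by (simp add: prod.remove subset_insertI2)
  qed
  also have "\<dots> = (\<Sum>b\<in>S. (if k a = k b then (s (k a))\<^sup>2 else 0) *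
      expectation (\<lambda>\<omega>. \<Prod>e\<in>S - {b}. X (k e) \<omega>))"
    unfolding B_def using S(1) by (subst sum.inter_filter) (auto intro!: sum.cong)
  finally show ?thesis .
qed

lemma expectation_pair_normal_family:
  assumes "a \<noteq> b" "k a \<in> I" "k b \<in> I"
  shows "expectation (\<lambda>\<omega>. \<Prod>e\<in>{a, b}. X (k e) \<omega>) = (if k a = k b then (s (k a))\<^sup>2 else 0)"
  using expectation_prod_normal_family_insert[of "{b}" a k] assms by (simp add: prob_space)

text \<open>The induction is over proper subsets because one step removes both \<open>a\<close> and
  its partner \<open>b\<close>. Sets of odd size need no separate case: for a single element the sum
  over partners is empty.\<close>

theorem isserlis:
  assumes "finite T" "k ` T \<subseteq> I"
  shows "expectation (\<lambda>\<omega>. \<Prod>e\<in>T. X (k e) \<omega>) =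
    (\<Sum>\<phi>\<in>pairings T. \<Prod>p\<in>\<phi>. expectation (\<lambda>\<omega>. \<Prod>e\<in>p. X (k e) \<omega>))"
  using assms
proof (induction T rule: finite_psubset_induct)
  case (psubset T)
  show ?case
  proof (cases "T = {}")
    case True
    then show ?thesis by (simp add: pairings_empty prob_space)
  next
    case False
    then obtain a where "a \<in> T" by blast
    define S where "S = T - {a}"
    have S: "T = insert a S" "a \<notin> S" "finite S" using \<open>a \<in> T\<close> psubset by (auto simp: S_def)
    have "expectation (\<lambda>\<omega>. \<Prod>e\<in>T. X (k e) \<omega>) = (\<Sum>b\<in>S. expectation (\<lambda>\<omega>. \<Prod>e\<in>{a, b}. X (k e) \<omega>) *
        (\<Sum>\<phi>\<in>pairings (S - {b}). \<Prod>p\<in>\<phi>. expectation (\<lambda>\<omega>. \<Prod>e\<in>p. X (k e) \<omega>)))"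
      unfolding S(1)
    proof (subst expectation_prod_normal_family_insert)
      show "k ` insert a S \<subseteq> I" using psubset(3) S(1) by simp
    next
      show "(\<Sum>b\<in>S. (if k a = k b then (s (k a))\<^sup>2 else 0) * expectation (\<lambda>\<omega>. \<Prod>e\<in>S - {b}. X (k e) \<omega>)) =
        (\<Sum>b\<in>S. expectation (\<lambda>\<omega>. \<Prod>e\<in>{a, b}. X (k e) \<omega>) *
        (\<Sum>\<phi>\<in>pairings (S - {b}). \<Prod>p\<in>\<phi>. expectation (\<lambda>\<omega>. \<Prod>e\<in>p. X (k e) \<omega>)))"
        using S psubset(3)
        by (intro sum.cong refl arg_cong2[where f="(*)"] psubset.IH
            expectation_pair_normal_family[symmetric]) auto
    qed (use S in auto)
    then show ?thesis unfolding S(1) by (simp add: sum_pairings_insert[OF S(3,2)])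
  qed
qed

end

end

section \<open>Index assignments on a quotient and the value of the identified graph\<close>

lemma bij_betw_PiE_quotient:
  assumes R: "equiv V R" and B: "\<And>v. v \<in> V \<Longrightarrow> cB (R `` {v}) = B v"
  shows "bij_betw (\<lambda>j. \<lambda>v\<in>V. j (R `` {v})) (\<Pi>\<^sub>E C\<in>V // R. cB C)
    {i \<in> (\<Pi>\<^sub>E v\<in>V. B v). \<forall>u v. (u, v) \<in> R \<longrightarrow> i u = i v}"
  unfolding bij_betw_def
proof
  let ?f = "\<lambda>j. \<lambda>v\<in>V. j (R `` {v})"
  show "inj_on ?f (\<Pi>\<^sub>E C\<in>V // R. cB C)"
  proof (rule inj_onI)
    fix j j' assume j: "j \<in> (\<Pi>\<^sub>E C\<in>V // R. cB C)" "j' \<in> (\<Pi>\<^sub>E C\<in>V // R. cB C)" and eq: "?f j = ?f j'"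
    show "j = j'"
    proof (rule PiE_ext[OF j])
      fix C assume "C \<in> V // R"
      then obtain v where "v \<in> V" "C = R `` {v}" by (rule quotientE)
      then show "j C = j' C" using fun_cong[OF eq, of v] by simp
    qed
  qed
  show "?f ` (\<Pi>\<^sub>E C\<in>V // R. cB C) = {i \<in> (\<Pi>\<^sub>E v\<in>V. B v). \<forall>u v. (u, v) \<in> R \<longrightarrow> i u = i v}"
  proof (intro equalityI subsetI)
    fix i assume "i \<in> ?f ` (\<Pi>\<^sub>E C\<in>V // R. cB C)"
    then obtain j where j: "j \<in> (\<Pi>\<^sub>E C\<in>V // R. cB C)" and i: "i = ?f j" by blast
    have "j (R `` {v}) \<in> B v" if "v \<in> V" for v
      using PiE_mem[OF j quotientI[OF that]] B[OF that] by simp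
    then have "i \<in> (\<Pi>\<^sub>E v\<in>V. B v)" by (simp add: i)
    moreover have "i u = i v" if "(u, v) \<in> R" for u v
    proof -
      have "u \<in> V" "v \<in> V" using that R by (auto simp: equiv_def refl_on_def)
      then show ?thesis using equiv_class_eq[OF R that] by (simp add: i)
    qed
    ultimately show "i \<in> {i \<in> (\<Pi>\<^sub>E v\<in>V. B v). \<forall>u v. (u, v) \<in> R \<longrightarrow> i u = i v}" by blast
  next
    fix i assume "i \<in> {i \<in> (\<Pi>\<^sub>E v\<in>V. B v). \<forall>u v. (u, v) \<in> R \<longrightarrow> i u = i v}"
    then have i: "i \<in> (\<Pi>\<^sub>E v\<in>V. B v)" and const: "\<And>u v. (u, v) \<in> R \<Longrightarrow> i u = i v" by blast+
    define j where "j = (\<lambda>C\<in>V // R. i (SOME v. v \<in> C))"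
    have jR: "j (R `` {v}) = i v" if v: "v \<in> V" for v
    proof -
      have "(SOME u. u \<in> R `` {v}) \<in> R `` {v}"
        using equiv_class_self[OF R v] by (rule someI)
      then show ?thesis using const[of v "SOME u. u \<in> R `` {v}"] v by (simp add: j_def quotientI)
    qed
    have "j \<in> (\<Pi>\<^sub>E C\<in>V // R. cB C)"
    proof (rule PiE_I)
      fix C assume "C \<in> V // R"
      then obtain v where "v \<in> V" "C = R `` {v}" by (rule quotientE)
      then show "j C \<in> cB C" using jR[of v] B[of v] PiE_mem[OF i, of v] by simp
    qed (simp add: j_def)
    moreover have "i = ?f j"
    proof
      fix v show "i v = ?f j v"
        using jR PiE_arb[OF i, of v] by (cases "v \<in> V") simp_all
    qed
    ultimately show "i \<in> ?f ` (\<Pi>\<^sub>E C\<in>V // R. cB C)" by blast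
  qed
qed

text \<open>For a pair of random arcs this is the covariance of the two matrix entries selected by
  \<open>i\<close>. It is total on arc sets so that inadmissible pairs can be included in sums, with
  weight 0. The value in the \<open>Det\<close> branch is a filler, since the weight is taken only
  at pairs of random arcs.\<close>

definition pair_weight ::
  "(nat \<Rightarrow> real) \<Rightarrow> ('v, 'e, edge_input) product_graph \<Rightarrow> ('v \<Rightarrow> nat) \<Rightarrow> 'e set \<Rightarrow> real" where
  "pair_weight \<sigma> G i p =
     (if \<forall>e\<in>p. \<forall>e'\<in>p. einput G e = einput G e' \<and>
           i (head (digr G) e) = i (head (digr G) e') \<and> i (tail (digr G) e) = i (tail (digr G) e')
      then case the_elem (einput G ` p) of Det A \<Rightarrow> 0 | Rand l \<Rightarrow> (\<sigma> l)\<^sup>2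
      else 0)"

lemma the_elem_constant_image:
  assumes "x \<in> A" "\<And>y. y \<in> A \<Longrightarrow> f y = f x"
  shows "the_elem (f ` A) = f x"
proof -
  have "f ` A = {f x}" using assms by blast
  then show ?thesis by simp
qed

lemma wf_product_graphD:
  assumes wf: "wf_product_graph shape G"
  shows "fin_digraph (digr G)"
    and "\<And>e. e \<in> arcs (digr G) \<Longrightarrow> head (digr G) e \<in> verts (digr G) \<and> tail (digr G) e \<in> verts (digr G)"
    and "\<And>e. e \<in> arcs (digr G) \<Longrightarrow>
      shape (einput G e) = (vdim G (head (digr G) e), vdim G (tail (digr G) e))"
proof -
  show "fin_digraph (digr G)" using wf by (simp add: wf_product_graph_def)
  then interpret fin_digraph "digr G" .
  show "\<And>e. e \<in> arcs (digr G) \<Longrightarrow> head (digr G) e \<in> verts (digr G) \<and> tail (digr G) e \<in> verts (digr G)" by simp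
  show "\<And>e. e \<in> arcs (digr G) \<Longrightarrow>
      shape (einput G e) = (vdim G (head (digr G) e), vdim G (tail (digr G) e))"
    using wf unfolding wf_product_graph_def by blast
qed

lemma identify_simps:
  "verts (digr (identify \<sigma> G \<phi>)) = verts (digr G) // vertex_ident G \<phi>"
  "arcs (digr (identify \<sigma> G \<phi>)) = \<phi> \<union> (\<lambda>e. {e}) ` (arcs (digr G) - random_arcs G)"
  "head (digr (identify \<sigma> G \<phi>)) a = vertex_ident G \<phi> `` (head (digr G) ` a)"
  "tail (digr (identify \<sigma> G \<phi>)) a = vertex_ident G \<phi> `` (tail (digr G) ` a)"
  "vdim (identify \<sigma> G \<phi>) C = the_elem (vdim G ` C)"
  "vinput (identify \<sigma> G \<phi>) C =
     Matrix.vec (the_elem (vdim G ` C)) (\<lambda>x. \<Prod>v\<in>C. vec_index (vinput G v) x)"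
  "einput (identify \<sigma> G \<phi>) a = (case the_elem (einput G ` a) of
              Det A \<Rightarrow> A
            | Rand l \<Rightarrow> (\<sigma> l)\<^sup>2 \<cdot>\<^sub>m Matrix.mat (the_elem (vdim G ` (vertex_ident G \<phi> `` (head (digr G) ` a))))
                (the_elem (vdim G ` (vertex_ident G \<phi> `` (tail (digr G) ` a)))) (\<lambda>_. 1))"
  by (simp_all add: identify_def Let_def)

context
  fixes \<sigma> :: "nat \<Rightarrow> real" and G :: "('v, 'e, edge_input) product_graph" and \<phi> :: "'e set set"
    and Nr Nc :: "nat \<Rightarrow> nat"
  assumes wf: "wf_product_graph (input_shape Nr Nc) G" and \<phi>: "\<phi> \<in> admissible_pairings G"
begin


lemma pair_subset_arcs: "p \<in> \<phi> \<Longrightarrow> p \<subseteq> arcs (digr G)"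
  using admissible_pairingsD(1)[OF \<phi>] by (auto simp: random_arcs_def)

lemma vertex_ident_heads_tails:
  assumes "p \<in> \<phi>" "e \<in> p" "e' \<in> p"
  shows "(head (digr G) e, head (digr G) e') \<in> vertex_ident G \<phi>" "(tail (digr G) e, tail (digr G) e') \<in> vertex_ident G \<phi>"
proof -
  have "e \<in> arcs (digr G)" "e' \<in> arcs (digr G)" using pair_subset_arcs assms by blast+
  then show "(head (digr G) e, head (digr G) e') \<in> vertex_ident G \<phi>" "(tail (digr G) e, tail (digr G) e') \<in> vertex_ident G \<phi>"
    using assms wf_product_graphD(2)[OF wf] by (auto simp: vertex_ident_def intro: vertex_glue.intros)
qed

text \<open>Equality of values passes from the generating pairs in \<open>vertex_glue\<close> to
  their reflexive transitive closure. The right side is the condition on \<open>i\<close> tested by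
  \<open>pair_weight\<close>.\<close>

lemma constant_on_vertex_ident_iff:
  "(\<forall>u v. (u, v) \<in> vertex_ident G \<phi> \<longrightarrow> i u = i v) \<longleftrightarrow>
   (\<forall>p\<in>\<phi>. \<forall>e\<in>p. \<forall>e'\<in>p. i (head (digr G) e) = i (head (digr G) e') \<and>
      i (tail (digr G) e) = i (tail (digr G) e'))" (is "?L \<longleftrightarrow> ?R")
proof
  assume ?L
  then show ?R using vertex_ident_heads_tails by blast
next
  assume r: ?R
  have glue: "i u = i v" if "(u, v) \<in> vertex_glue G \<phi>" for u v
    using that by cases (use r in blast)+
  have "i u = i v" if "(u, v) \<in> (vertex_glue G \<phi>)\<^sup>*" for u v
    using that by (induction rule: rtrancl_induct) (simp_all add: glue)
  then show ?L by (simp add: vertex_ident_def)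
qed

lemma vdim_identify_class:
  assumes "v \<in> verts (digr G)"
  shows "the_elem (vdim G ` (vertex_ident G \<phi> `` {v})) = vdim G v"
  using equiv_class_self[OF equiv_vertex_ident assms]
proof (rule the_elem_constant_image)
  fix u assume "u \<in> vertex_ident G \<phi> `` {v}"
  then show "vdim G u = vdim G v" using vertex_ident_vdim[OF wf \<phi>, of v u] by simp
qed

text \<open>Lets any single arc stand for its pair when endpoints in the identified graph are
  computed.\<close>

lemma vertex_class_of_pair:
  assumes "p \<in> \<phi>" "e \<in> p"
  shows "vertex_ident G \<phi> `` (head (digr G) ` p) = vertex_ident G \<phi> `` {head (digr G) e}"
    and "vertex_ident G \<phi> `` (tail (digr G) ` p) = vertex_ident G \<phi> `` {tail (digr G) e}"
proof -
  have "vertex_ident G \<phi> `` {head (digr G) e'} = vertex_ident G \<phi> `` {head (digr G) e}"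
    "vertex_ident G \<phi> `` {tail (digr G) e'} = vertex_ident G \<phi> `` {tail (digr G) e}" if "e' \<in> p" for e'
    using vertex_ident_heads_tails[OF assms(1) that assms(2)]
    by (auto dest: equiv_class_eq[OF equiv_vertex_ident])
  then show "vertex_ident G \<phi> `` (head (digr G) ` p) = vertex_ident G \<phi> `` {head (digr G) e}"
    "vertex_ident G \<phi> `` (tail (digr G) ` p) = vertex_ident G \<phi> `` {tail (digr G) e}" using assms(2) by blast+
qed

text \<open>A nonconstant assignment separates the heads or the tails of some pair, whose weight is
  then 0.\<close>

lemma prod_pair_weight_eq_0:
  assumes "\<not> (\<forall>u v. (u, v) \<in> vertex_ident G \<phi> \<longrightarrow> i u = i v)"
  shows "(\<Prod>p\<in>\<phi>. pair_weight \<sigma> G i p) = 0"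
proof -
  interpret fin_digraph "digr G" by (rule wf_product_graphD(1)[OF wf])
  have "\<phi> \<subseteq> Pow (arcs (digr G))" using pair_subset_arcs by blast
  then have "finite \<phi>" by (rule finite_subset) simp
  moreover have "\<exists>p\<in>\<phi>. pair_weight \<sigma> G i p = 0"
    using assms unfolding constant_on_vertex_ident_iff pair_weight_def by meson
  ultimately show ?thesis by (simp add: prod_zero)
qed

text \<open>The argument \<open>w\<close> is a dummy: only arcs with deterministic input are realized.\<close>

lemma graph_value_identify:
  "graph_value (identify \<sigma> G \<phi>) =
    (\<Sum>i\<in>(\<Pi>\<^sub>E v\<in>verts (digr G). {..<vdim G v}).
       (\<Prod>p\<in>\<phi>. pair_weight \<sigma> G i p) *
       (\<Prod>e\<in>arcs (digr G) - random_arcs G.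
          realize_input w (einput G e) $$ (i (head (digr G) e), i (tail (digr G) e))) *
       (\<Prod>v\<in>verts (digr G). vec_index (vinput G v) (i v)))"
proof -
  interpret fin_digraph "digr G" by (rule wf_product_graphD(1)[OF wf])
  let ?D = "digr G" and ?H = "identify \<sigma> G \<phi>"
  let ?S = "\<Pi>\<^sub>E v\<in>verts (digr G). {..<vdim G v}"
  let ?T = "{i \<in> ?S. \<forall>u v. (u, v) \<in> vertex_ident G \<phi> \<longrightarrow> i u = i v}"
  let ?J = "\<Pi>\<^sub>E C\<in>verts (digr G) // vertex_ident G \<phi>. {..<the_elem (vdim G ` C)}"
  let ?f = "\<lambda>j. \<lambda>v\<in>verts (digr G). j (vertex_ident G \<phi> `` {v})"
  define F where "F i = (\<Prod>p\<in>\<phi>. pair_weight \<sigma> G i p) *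
       (\<Prod>e\<in>arcs ?D - random_arcs G.
          realize_input w (einput G e) $$ (i (head ?D e), i (tail ?D e))) *
       (\<Prod>v\<in>verts (digr G). vec_index (vinput G v) (i v))" for i
  have eq: "equiv (verts (digr G)) (vertex_ident G \<phi>)" by (rule equiv_vertex_ident)
  have bij: "bij_betw ?f ?J ?T"
    by (rule bij_betw_PiE_quotient[OF eq]) (simp add: vdim_identify_class)
  \<comment> \<open>Only assignments constant on the classes survive, and \<open>bij\<close> matches
    these with the assignments of the identified graph.\<close>
  have "finite ?S" by (intro finite_PiE) auto
  then have "(\<Sum>i\<in>?S. F i) = (\<Sum>i\<in>?T. F i)"
    by (intro sum.mono_neutral_right) (auto simp: F_def prod_pair_weight_eq_0)
  also have "\<dots> = (\<Sum>j\<in>?J. F (?f j))"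
    by (rule sum.reindex_bij_betw[OF bij, symmetric])
  also have "\<dots> = graph_value ?H"
    unfolding graph_value_def identify_simps
  proof (rule sum.cong[OF refl])
    fix j assume j: "j \<in> ?J"
    define i where "i = ?f j"
    have i: "i v = j (vertex_ident G \<phi> `` {v})" if "v \<in> verts (digr G)" for v using that by (simp add: i_def)
    have iT: "i \<in> ?T" unfolding i_def using bij_betwE[OF bij] j by (rule bspec)
    then have const: "\<And>p e e'. p \<in> \<phi> \<Longrightarrow> e \<in> p \<Longrightarrow> e' \<in> p \<Longrightarrow>
        i (head ?D e) = i (head ?D e') \<and> i (tail ?D e) = i (tail ?D e')"
      and iS: "i \<in> ?S"
      unfolding constant_on_vertex_ident_iff mem_Collect_eq by blast+
    have lt: "i v < vdim G v" if "v \<in> verts (digr G)" for v using PiE_mem[OF iS that] by simp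
    let ?entry = "\<lambda>a. einput ?H a $$ (j (vertex_ident G \<phi> `` (head ?D ` a)), j (vertex_ident G \<phi> `` (tail ?D ` a)))"
    have pair: "?entry p = pair_weight \<sigma> G i p" if p: "p \<in> \<phi>" for p
    proof -
      obtain e where e: "e \<in> p" using admissible_pairingsD(2)[OF \<phi> p] by blast
      then have arc: "e \<in> arcs ?D" using pair_subset_arcs p by blast
      have same: "\<And>e e'. e \<in> p \<Longrightarrow> e' \<in> p \<Longrightarrow> einput G e = einput G e'"
        using admissible_pairingsD(3)[OF \<phi> p] .
      have "e \<in> random_arcs G" using admissible_pairingsD(1)[OF \<phi> p] e by blast
      then obtain l where l: "einput G e = Rand l" by (auto simp: random_arcs_def)
      have elem: "the_elem (einput G ` p) = Rand l"
        using the_elem_constant_image[OF e, of "einput G"] same[OF _ e] l by simp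
      have "\<forall>e\<in>p. \<forall>e'\<in>p. einput G e = einput G e' \<and>
           i (head ?D e) = i (head ?D e') \<and> i (tail ?D e) = i (tail ?D e')"
        using same const[OF p] by blast
      then have "pair_weight \<sigma> G i p = (\<sigma> l)\<^sup>2"
        by (simp only: pair_weight_def elem if_P edge_input.case)
      \<comment> \<open>The bounds in \<open>lt\<close> place the indices inside the all-ones
        matrix, so only the scalar remains.\<close>
      moreover have "?entry p = (\<sigma> l)\<^sup>2"
        using lt wf_product_graphD(2)[OF wf arc]
        by (simp add: identify_simps elem vertex_class_of_pair[OF p e] vdim_identify_class flip: i)
      ultimately show ?thesis by simp
    qed
    have det: "?entry {e} = realize_input w (einput G e) $$ (i (head ?D e), i (tail ?D e))"
      if "e \<in> arcs ?D - random_arcs G" for e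
    proof -
      from that obtain A where "einput G e = Det A"
        by (cases "einput G e") (auto simp: random_arcs_def)
      then show ?thesis using wf_product_graphD(2)[OF wf, of e] that by (simp add: identify_simps flip: i)
    qed
    have "(\<Prod>a\<in>\<phi> \<union> (\<lambda>e. {e}) ` (arcs ?D - random_arcs G). ?entry a) =
        (\<Prod>p\<in>\<phi>. ?entry p) * (\<Prod>a\<in>(\<lambda>e. {e}) ` (arcs ?D - random_arcs G). ?entry a)"
    proof (rule prod.union_disjoint)
      show "finite \<phi>"
        by (rule finite_subset[of _ "Pow (arcs ?D)"]) (use pair_subset_arcs in auto)
      \<comment> \<open>Blocks of \<open>\<phi>\<close> consist of random arcs, while the singletons
        come from deterministic ones.\<close>
      show "\<phi> \<inter> (\<lambda>e. {e}) ` (arcs ?D - random_arcs G) = {}"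
        using admissible_pairingsD(1)[OF \<phi>] by blast
    qed simp
    also have "(\<Prod>p\<in>\<phi>. ?entry p) = (\<Prod>p\<in>\<phi>. pair_weight \<sigma> G i p)"
      by (rule prod.cong[OF refl pair])
    also have "(\<Prod>a\<in>(\<lambda>e. {e}) ` (arcs ?D - random_arcs G). ?entry a) =
        (\<Prod>e\<in>arcs ?D - random_arcs G.
          realize_input w (einput G e) $$ (i (head ?D e), i (tail ?D e)))"
    proof -
      have "(\<Prod>a\<in>(\<lambda>e. {e}) ` (arcs ?D - random_arcs G). ?entry a) =
          (\<Prod>e\<in>arcs ?D - random_arcs G. ?entry {e})"
        by (rule prod.reindex_cong[where l="\<lambda>e. {e}"]) (simp_all add: inj_on_def)
      also have "\<dots> = (\<Prod>e\<in>arcs ?D - random_arcs G.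
          realize_input w (einput G e) $$ (i (head ?D e), i (tail ?D e)))"
        by (rule prod.cong[OF refl det])
      finally show ?thesis .
    qed
    finally have arcs: "(\<Prod>a\<in>\<phi> \<union> (\<lambda>e. {e}) ` (arcs ?D - random_arcs G). ?entry a) =
        (\<Prod>p\<in>\<phi>. pair_weight \<sigma> G i p) * (\<Prod>e\<in>arcs ?D - random_arcs G.
          realize_input w (einput G e) $$ (i (head ?D e), i (tail ?D e)))" .
    have "(\<Prod>C\<in>verts (digr G) // vertex_ident G \<phi>. vec_index (Matrix.vec (the_elem (vdim G ` C))
          (\<lambda>x. \<Prod>v\<in>C. vec_index (vinput G v) x)) (j C)) =
        (\<Prod>C\<in>verts (digr G) // vertex_ident G \<phi>. \<Prod>v\<in>C. vec_index (vinput G v) (i v))"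
    proof (rule prod.cong[OF refl])
      fix C assume C: "C \<in> verts (digr G) // vertex_ident G \<phi>"
      have "j C < the_elem (vdim G ` C)" using PiE_mem[OF j C] by simp
      moreover have "i v = j C" if "v \<in> C" for v
      proof -
        from C obtain u where u: "u \<in> verts (digr G)" "C = vertex_ident G \<phi> `` {u}"
          by (rule quotientE)
        then have "(u, v) \<in> vertex_ident G \<phi>" using that by simp
        then have "i u = i v" using iT by blast
        then show ?thesis using i[OF u(1)] u(2) by simp
      qed
      ultimately show "vec_index (Matrix.vec (the_elem (vdim G ` C))
          (\<lambda>x. \<Prod>v\<in>C. vec_index (vinput G v) x)) (j C) =
        (\<Prod>v\<in>C. vec_index (vinput G v) (i v))" by (simp cong: prod.cong)
    qed
    \<comment> \<open>The classes partition the vertices, so the nested product runs over every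
      vertex once.\<close>
    also have "\<dots> = (\<Prod>v\<in>verts (digr G). vec_index (vinput G v) (i v))"
      by (rule prod.partition[symmetric, OF _ partition_on_quotient[OF eq]]) simp
    finally have verts: "(\<Prod>C\<in>verts (digr G) // vertex_ident G \<phi>. vec_index (Matrix.vec (the_elem (vdim G ` C))
          (\<lambda>x. \<Prod>v\<in>C. vec_index (vinput G v) x)) (j C)) =
        (\<Prod>v\<in>verts (digr G). vec_index (vinput G v) (i v))" .
    show "F (?f j) = (\<Prod>a\<in>\<phi> \<union> (\<lambda>e. {e}) ` (arcs ?D - random_arcs G).
           (case the_elem (einput G ` a) of
              Det A \<Rightarrow> A
            | Rand l \<Rightarrow> (\<sigma> l)\<^sup>2 \<cdot>\<^sub>m Matrix.mat (the_elem (vdim G ` (vertex_ident G \<phi> `` (head (digr G) ` a))))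
                (the_elem (vdim G ` (vertex_ident G \<phi> `` (tail (digr G) ` a)))) (\<lambda>_. 1)) $$
            (j (vertex_ident G \<phi> `` (head ?D ` a)), j (vertex_ident G \<phi> `` (tail ?D ` a)))) *
          (\<Prod>C\<in>verts (digr G) // vertex_ident G \<phi>. vec_index (Matrix.vec (the_elem (vdim G ` C))
          (\<lambda>x. \<Prod>v\<in>C. vec_index (vinput G v) x)) (j C))"
      using arcs unfolding identify_simps verts by (simp add: F_def flip: i_def)
  qed
  finally show ?thesis unfolding F_def by (rule sym)
qed

end

section \<open>Expectation of the graph value\<close>

text \<open>Independence of the matrices and of the entries within each matrix combine by
  \<open>indep_vars_Sigma\<close>. On \<open>mat_index\<close> the restricted function
  \<open>mat_entries\<close> agrees with the plain entries.\<close>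

lemma (in prob_space) indep_vars_entries:
  assumes iid: "\<And>l. iid_normal_mat M (Nr l) (Nc l) (\<sigma> l) (W l)"
    and indep: "indep_vars (\<lambda>l. PiM (mat_index (Nr l) (Nc l)) (\<lambda>_. borel))
           (\<lambda>l \<omega>. mat_entries (Nr l) (Nc l) (W l \<omega>)) UNIV"
  shows "indep_vars (\<lambda>_. borel) (\<lambda>(l, p) \<omega>. W l \<omega> $$ p) (SIGMA l:UNIV. mat_index (Nr l) (Nc l))"
proof -
  have "indep_vars (\<lambda>_. borel) (\<lambda>p \<omega>. mat_entries (Nr l) (Nc l) (W l \<omega>) p) (mat_index (Nr l) (Nc l))" for l
  proof -
    have "indep_vars (\<lambda>_. borel) (\<lambda>p \<omega>. W l \<omega> $$ p) (mat_index (Nr l) (Nc l))"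
      using iid by (simp add: iid_normal_mat_def)
    then show ?thesis
      by (rule indep_vars_cong[THEN iffD1, rotated -1]) (simp_all add: mat_entries_def)
  qed
  then have "indep_vars (\<lambda>(l, p). borel) (\<lambda>(l, p) \<omega>. mat_entries (Nr l) (Nc l) (W l \<omega>) p)
      (SIGMA l:UNIV. mat_index (Nr l) (Nc l))"
    by (intro indep_vars_Sigma[OF indep])
  then show ?thesis
    by (rule indep_vars_cong[THEN iffD1, rotated -1]) (auto simp: mat_entries_def)
qed

lemma admissible_pairings_eq:
  "admissible_pairings G =
    {\<phi> \<in> pairings (random_arcs G). \<forall>p\<in>\<phi>. \<forall>e\<in>p. \<forall>e'\<in>p. einput G e = einput G e'}"
  by (auto simp: admissible_pairings_def pairings_def)

theorem theorem6:
  fixes M :: "'a measure"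
    and Nr Nc :: "nat \<Rightarrow> nat"
    and \<sigma> :: "nat \<Rightarrow> real"
    and W :: "nat \<Rightarrow> 'a \<Rightarrow> real mat"
    and G :: "('v, 'v \<times> 'v, edge_input) product_graph"
  assumes "prob_space M"
    and "\<And>l. iid_normal_mat M (Nr l) (Nc l) (\<sigma> l) (W l)"
    and "prob_space.indep_vars M
           (\<lambda>l. PiM (mat_index (Nr l) (Nc l)) (\<lambda>_. borel))
           (\<lambda>l \<omega>. mat_entries (Nr l) (Nc l) (W l \<omega>)) UNIV"
    and "wf_product_graph (input_shape Nr Nc) G"
    and "simple_arcs (digr G)"
  shows "integrable M (\<lambda>\<omega>. graph_value (realize (\<lambda>l. W l \<omega>) G)) \<and>
         prob_space.expectation M (\<lambda>\<omega>. graph_value (realize (\<lambda>l. W l \<omega>) G)) =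
           (\<Sum>\<phi>\<in>admissible_pairings G. graph_value (identify \<sigma> G \<phi>))"
proof -
  interpret prob_space M by fact
  note wf = assms(4)
  interpret fin_digraph "digr G" by (rule wf_product_graphD(1)[OF wf])
  let ?D = "digr G"
  define I where "I = (SIGMA l:UNIV. mat_index (Nr l) (Nc l))"
  define X where "X = (\<lambda>(l, p) \<omega>. W l \<omega> $$ p)"
  \<comment> \<open>The value for deterministic arcs is arbitrary, since products involving
    \<open>label\<close> run over random arcs only.\<close>
  define label where "label e = (case einput G e of Rand l \<Rightarrow> l | Det A \<Rightarrow> undefined)" for e
  \<comment> \<open>The name of the matrix entry that arc \<open>e\<close> contributes under
    \<open>i\<close>. Distinct arcs may share it, which is the repetition allowed in
    \<open>isserlis\<close>.\<close>
  define k where "k i e = (label e, i (head ?D e), i (tail ?D e))" for i :: "'v \<Rightarrow> nat" and e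
  let ?S = "\<Pi>\<^sub>E v\<in>verts ?D. {..<vdim G v}"
  let ?E = "random_arcs G"
  \<comment> \<open>The empty matrix is a dummy realization; it instantiates \<open>w\<close> in
    \<open>graph_value_identify\<close>.\<close>
  define det where "det i = (\<Prod>e\<in>arcs ?D - ?E.
      realize_input (\<lambda>_. 0\<^sub>m 0 0) (einput G e) $$ (i (head ?D e), i (tail ?D e)))" for i
  define vert where "vert i = (\<Prod>v\<in>verts ?D. vec_index (vinput G v) (i v))" for i
  have ind: "indep_vars (\<lambda>_. borel) X I"
    unfolding X_def I_def by (rule indep_vars_entries[OF assms(2,3)])
  have nrm: "distr M borel (X x) = normal_measure 0 (\<sigma> (fst x))" if "x \<in> I" for x
    using assms(2)[of "fst x"] that by (auto simp: iid_normal_mat_def X_def I_def case_prod_unfold)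
  have E: "?E \<subseteq> arcs ?D" "finite ?E" by (auto simp: random_arcs_def intro: finite_subset[OF _ finite_arcs])
  have label: "einput G e = Rand (label e)" if "e \<in> ?E" for e
    using that by (auto simp: random_arcs_def label_def)
  have kI: "k i ` ?E \<subseteq> I" if i: "i \<in> ?S" for i
  proof
    fix x assume "x \<in> k i ` ?E"
    then obtain e where e: "e \<in> ?E" "x = k i e" by blast
    then have arc: "e \<in> arcs ?D" using E(1) by blast
    have "Nr (label e) = vdim G (head ?D e)" "Nc (label e) = vdim G (tail ?D e)"
      using wf_product_graphD(3)[OF wf arc] by (simp_all add: label[OF e(1)])
    moreover have "i (head ?D e) < vdim G (head ?D e)" "i (tail ?D e) < vdim G (tail ?D e)"
      using PiE_mem[OF i head_in_verts[OF arc]] PiE_mem[OF i tail_in_verts[OF arc]] by simp_all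
    ultimately show "x \<in> I" by (simp add: e(2) I_def k_def mat_index_def)
  qed
  have val: "graph_value (realize (\<lambda>l. W l \<omega>) G) =
      (\<Sum>i\<in>?S. det i * vert i * (\<Prod>e\<in>?E. X (k i e) \<omega>))" for \<omega>
  proof -
    have "(\<Prod>e\<in>arcs ?D. realize_input (\<lambda>l. W l \<omega>) (einput G e) $$ (i (head ?D e), i (tail ?D e))) =
        det i * (\<Prod>e\<in>?E. X (k i e) \<omega>)" for i
    proof -
      have "(\<Prod>e\<in>arcs ?D - ?E. realize_input (\<lambda>l. W l \<omega>) (einput G e) $$ (i (head ?D e), i (tail ?D e))) = det i"
        unfolding det_def
      proof (rule prod.cong[OF refl])
        fix e assume "e \<in> arcs ?D - ?E"
        then show "realize_input (\<lambda>l. W l \<omega>) (einput G e) $$ (i (head ?D e), i (tail ?D e)) =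
            realize_input (\<lambda>_. 0\<^sub>m 0 0) (einput G e) $$ (i (head ?D e), i (tail ?D e))"
          by (cases "einput G e") (simp_all add: random_arcs_def)
      qed
      moreover have "(\<Prod>e\<in>?E. realize_input (\<lambda>l. W l \<omega>) (einput G e) $$ (i (head ?D e), i (tail ?D e))) =
          (\<Prod>e\<in>?E. X (k i e) \<omega>)"
        by (rule prod.cong[OF refl]) (simp add: label X_def k_def)
      ultimately show ?thesis by (simp only: prod.subset_diff[OF E(1) finite_arcs])
    qed
    then show ?thesis
      by (simp add: graph_value_def realize_def vert_def ac_simps)
  qed
  have int: "integrable M (\<lambda>\<omega>. \<Prod>e\<in>?E. X (k i e) \<omega>)" if "i \<in> ?S" for i
    by (rule integrable_prod_normal_family[OF ind nrm E(2) kI[OF that]])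
  have pair: "expectation (\<lambda>\<omega>. \<Prod>e\<in>p. X (k i e) \<omega>) = pair_weight \<sigma> G i p"
    if i: "i \<in> ?S" and p: "p \<subseteq> ?E" "card p = 2" for i p
  proof -
    obtain a b where ab: "p = {a, b}" "a \<noteq> b" using p(2) by (auto simp: card_2_iff)
    then have in_E: "a \<in> ?E" "b \<in> ?E" using p(1) by auto
    then have kab: "k i a \<in> I" "k i b \<in> I" using kI[OF i] by blast+
    have "expectation (\<lambda>\<omega>. \<Prod>e\<in>{a, b}. X (k i e) \<omega>) =
        (if k i a = k i b then (\<sigma> (fst (k i a)))\<^sup>2 else 0)"
      by (rule expectation_pair_normal_family[OF ind nrm ab(2) kab])
    also have "\<dots> = pair_weight \<sigma> G i p"
    proof (cases "k i a = k i b")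
      case True
      then have eq: "einput G b = einput G a" "i (head ?D b) = i (head ?D a)" "i (tail ?D b) = i (tail ?D a)"
        by (simp_all add: k_def label in_E)
      then have "pair_weight \<sigma> G i p = (\<sigma> (label a))\<^sup>2"
        unfolding pair_weight_def ab by (simp add: label[OF in_E(1)])
      then show ?thesis unfolding if_P[OF True] by (simp add: k_def)
    next
      case False
      \<comment> \<open>Different entries come from different matrices or from different indices;
        equal inputs would force equal labels, so in either case the test in
        \<open>pair_weight\<close> fails.\<close>
      have "label a = label b" if "einput G a = einput G b"
        using that by (simp add: label_def)
      then have "\<not> (\<forall>e\<in>p. \<forall>e'\<in>p. einput G e = einput G e' \<and>
          i (head ?D e) = i (head ?D e') \<and> i (tail ?D e) = i (tail ?D e'))"
        using False unfolding ab k_def by blast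
      then have "pair_weight \<sigma> G i p = 0"
        unfolding pair_weight_def by (rule if_not_P)
      then show ?thesis using False by simp
    qed
    finally show ?thesis unfolding ab .
  qed
  have wick: "expectation (\<lambda>\<omega>. \<Prod>e\<in>?E. X (k i e) \<omega>) =
      (\<Sum>\<phi>\<in>admissible_pairings G. \<Prod>p\<in>\<phi>. pair_weight \<sigma> G i p)" if i: "i \<in> ?S" for i
  proof -
    have "expectation (\<lambda>\<omega>. \<Prod>e\<in>?E. X (k i e) \<omega>) =
        (\<Sum>\<phi>\<in>pairings ?E. \<Prod>p\<in>\<phi>. expectation (\<lambda>\<omega>. \<Prod>e\<in>p. X (k i e) \<omega>))"
      by (rule isserlis[OF ind nrm E(2) kI[OF i]])
    also have "\<dots> = (\<Sum>\<phi>\<in>pairings ?E. \<Prod>p\<in>\<phi>. pair_weight \<sigma> G i p)"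
    proof (rule sum.cong[OF refl], rule prod.cong[OF refl])
      fix \<phi> p assume "\<phi> \<in> pairings ?E" "p \<in> \<phi>"
      then show "expectation (\<lambda>\<omega>. \<Prod>e\<in>p. X (k i e) \<omega>) = pair_weight \<sigma> G i p"
        by (intro pair[OF i] pairingsD)
    qed
    also have "\<dots> = (\<Sum>\<phi>\<in>admissible_pairings G. \<Prod>p\<in>\<phi>. pair_weight \<sigma> G i p)"
    \<comment> \<open>A pairing that is not admissible has a pair with two different inputs, and
      this pair has weight 0.\<close>
    proof (rule sum.mono_neutral_right)
      show "finite (pairings ?E)" by (rule finite_pairings[OF E(2)])
      show "admissible_pairings G \<subseteq> pairings ?E" by (auto simp: admissible_pairings_eq)
      show "\<forall>\<phi>\<in>pairings ?E - admissible_pairings G. (\<Prod>p\<in>\<phi>. pair_weight \<sigma> G i p) = 0"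
      proof
        fix \<phi> assume \<phi>: "\<phi> \<in> pairings ?E - admissible_pairings G"
        then obtain p e e' where "p \<in> \<phi>" "e \<in> p" "e' \<in> p" "einput G e \<noteq> einput G e'"
          unfolding admissible_pairings_eq by blast
        then have "pair_weight \<sigma> G i p = 0" unfolding pair_weight_def by meson
        moreover have "finite \<phi>"
          using \<phi> finite_elements[OF E(2)] by (simp add: pairings_def)
        ultimately show "(\<Prod>p\<in>\<phi>. pair_weight \<sigma> G i p) = 0" using \<open>p \<in> \<phi>\<close>
          by (blast intro: prod_zero)
      qed
    qed
    finally show ?thesis .
  qed
  have "expectation (\<lambda>\<omega>. graph_value (realize (\<lambda>l. W l \<omega>) G)) =
      (\<Sum>i\<in>?S. det i * vert i * expectation (\<lambda>\<omega>. \<Prod>e\<in>?E. X (k i e) \<omega>))"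
    unfolding val by (subst Bochner_Integration.integral_sum) (simp_all add: int)
  also have "\<dots> = (\<Sum>i\<in>?S. \<Sum>\<phi>\<in>admissible_pairings G. (\<Prod>p\<in>\<phi>. pair_weight \<sigma> G i p) * det i * vert i)"
    by (intro sum.cong refl) (simp add: wick sum_distrib_left ac_simps)
  also have "\<dots> = (\<Sum>\<phi>\<in>admissible_pairings G. \<Sum>i\<in>?S. (\<Prod>p\<in>\<phi>. pair_weight \<sigma> G i p) * det i * vert i)"
    by (rule sum.swap)
  also have "\<dots> = (\<Sum>\<phi>\<in>admissible_pairings G. graph_value (identify \<sigma> G \<phi>))"
    unfolding det_def vert_def by (intro sum.cong refl graph_value_identify[OF wf, symmetric])
  finally show ?thesis unfolding val using int by simp
qed

end
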